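(* Let $\alpha>0$, $k\ge-1$, and let $H$ be the Hankel operator with kernel $h(t)=t^ke^{-\alpha t}$, i.e. the bounded self-adjoint operator $$(Hf)(t)=\int_0^\infty(t+s)^ke^{-\alpha(t+s)}f(s)\,ds$$ in $L^2(\mathbb R_+)$, $\mathbb R_+=(0,\infty)$. Then $H$ is positive for $k\in[-1,0]$, and it is not sign-definite for $k>0$.
   Context: "Positive" means $(Hf,f)\ge0$ for all $f\in L^2(\mathbb R_+)$. "Not sign-definite" means that neither $H\ge0$ nor $H\le0$ holds. *)

theory Defs
  imports "HOL-Analysis.Analysis"
begin

abbreviation Rplus :: "real measure"
  where "Rplus \<equiv> restrict_space lborel {0<..}"

text \<open>
  Elements of \<open>L\<^sup>2(\<real>\<^sub>+)\<close> are represented by Borel square-integrable functions. Since functions are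
  not identified when they agree almost everywhere, identities between elements are stated
  almost everywhere. Values outside \<open>(0,\<infinity>)\<close> are irrelevant.
\<close>

definition L2_Rplus :: "(real \<Rightarrow> complex) set"
  where "L2_Rplus =
    {f. f \<in> borel_measurable Rplus \<and> integrable Rplus (\<lambda>t. (cmod (f t))\<^sup>2)}"

definition L2_inner :: "(real \<Rightarrow> complex) \<Rightarrow> (real \<Rightarrow> complex) \<Rightarrow> complex"
  where "L2_inner f g = (LINT t|Rplus. f t * cnj (g t))"

definition L2_norm :: "(real \<Rightarrow> complex) \<Rightarrow> real"
  where "L2_norm f = sqrt (LINT t|Rplus. (cmod (f t))\<^sup>2)"

text \<open>
  Linearity and boundedness together make the operator well defined on almost-everywhere classes:
  if \<open>f = g\<close> almost everywhere, then \<open>f - g\<close> has norm zero, hence so has its image.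
\<close>

definition bounded_operator :: "((real \<Rightarrow> complex) \<Rightarrow> real \<Rightarrow> complex) \<Rightarrow> bool"
  where "bounded_operator T \<longleftrightarrow>
    (\<forall>f\<in>L2_Rplus. T f \<in> L2_Rplus) \<and>
    (\<forall>f\<in>L2_Rplus. \<forall>g\<in>L2_Rplus. AE t in Rplus. T (\<lambda>s. f s + g s) t = T f t + T g t) \<and>
    (\<forall>c. \<forall>f\<in>L2_Rplus. AE t in Rplus. T (\<lambda>s. c * f s) t = c * T f t) \<and>
    (\<exists>C. \<forall>f\<in>L2_Rplus. L2_norm (T f) \<le> C * L2_norm f)"

definition bounded_selfadjoint :: "((real \<Rightarrow> complex) \<Rightarrow> real \<Rightarrow> complex) \<Rightarrow> bool"
  where "bounded_selfadjoint T \<longleftrightarrow> bounded_operator T \<and>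
    (\<forall>f\<in>L2_Rplus. \<forall>g\<in>L2_Rplus. L2_inner (T f) g = L2_inner f (T g))"

definition positive_operator :: "((real \<Rightarrow> complex) \<Rightarrow> real \<Rightarrow> complex) \<Rightarrow> bool"
  where "positive_operator T \<longleftrightarrow> (\<forall>f\<in>L2_Rplus. L2_inner (T f) f \<in> \<real>\<^sub>\<ge>\<^sub>0)"

definition negative_operator :: "((real \<Rightarrow> complex) \<Rightarrow> real \<Rightarrow> complex) \<Rightarrow> bool"
  where "negative_operator T \<longleftrightarrow> (\<forall>f\<in>L2_Rplus. L2_inner (T f) f \<in> \<real>\<^sub>\<le>\<^sub>0)"

definition sign_definite :: "((real \<Rightarrow> complex) \<Rightarrow> real \<Rightarrow> complex) \<Rightarrow> bool"
  where "sign_definite T \<longleftrightarrow> positive_operator T \<or> negative_operator T"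

definition hankel_operator :: "(real \<Rightarrow> real) \<Rightarrow> (real \<Rightarrow> complex) \<Rightarrow> real \<Rightarrow> complex"
  where "hankel_operator h f t = (LINT s|Rplus. of_real (h (t + s)) * f s)"

text \<open>
  The defining integral converges absolutely, so that it is never replaced by the value \<open>0\<close> which
  the library gives to the integral of a non-integrable function.
\<close>

definition hankel_convergent :: "(real \<Rightarrow> real) \<Rightarrow> bool"
  where "hankel_convergent h \<longleftrightarrow>
    (\<forall>f\<in>L2_Rplus. \<forall>t>0. integrable Rplus (\<lambda>s. of_real (h (t + s)) * f s))"

end

theory Submission imports Defs begin

text \<open>
  Since \<open>k \<ge> -1\<close>, the kernel satisfies \<open>0 \<le> h(t) \<le> C/t\<close>. The Schur test with weight \<open>1 / \<surd>s\<close>,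
  based on \<open>\<integral> ds / ((t + s) \<surd>s) = \<pi> / \<surd>t\<close>, then bounds \<open>H\<close> by \<open>C\<pi>\<close>, and the same estimate
  makes the quadratic form absolutely convergent, which justifies all uses of Fubini.

  For \<open>k = -a < 0\<close> one has \<open>h(t + s) = \<integral> w(x) exp(-(x + \<alpha>)t) exp(-(x + \<alpha>)s) dx\<close> with
  \<open>w(x) = x powr (a - 1) / \<Gamma>(a)\<close>, so that \<open>(Hf, f)\<close>
  is an integral of squared moduli; for \<open>k = 0\<close> the operator has rank one.

  For \<open>k > 0\<close> the form is positive at the indicator \<open>v\<close> of \<open>(1,2)\<close>. As \<open>h(0+) = 0\<close>, the form of the normalised
  indicator \<open>u\<close> of \<open>(0,\<epsilon>)\<close> tends to \<open>0\<close> with \<open>\<epsilon>\<close> while \<open>(Hu, v)\<close> stays bounded below, so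
  that it is negative at \<open>v - A u\<close> for large \<open>A\<close> and small \<open>\<epsilon>\<close>.
\<close>

section \<open>Measure and integration on the half-line\<close>

interpretation Rplus: sigma_finite_measure Rplus
  by (rule sigma_finite_measure_restrict_space) (auto intro: sigma_finite_lborel)

interpretation Rplus_pair: pair_sigma_finite Rplus Rplus ..

lemma space_Rplus [simp]: "space Rplus = {0<..}"
  by (simp add: space_restrict_space)

lemma measurable_Rplus_ident [measurable]: "(\<lambda>x. x) \<in> borel_measurable Rplus"
  by (rule measurable_restrict_space1) simp

lemma measurable_cnj [measurable]: "cnj \<in> borel_measurable borel"
  by (intro borel_measurable_continuous_onI continuous_intros)

text \<open>The substitution s = t x^2 turns the integrand into a multiple of 1/(1 + x^2), so
  \<open>F\<close> below is an arctangent antiderivative. The lemma expresses that 1/sqrt(s) is an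
  eigenweight of the Carleman kernel 1/(t + s), with eigenvalue pi.\<close>

lemma nn_integral_carleman_weight:
  assumes "t > 0"
  shows "(\<integral>\<^sup>+s. ennreal (1 / ((t + s) * sqrt s)) \<partial>Rplus) = ennreal (pi / sqrt t)"
proof -
  define F where "F = (\<lambda>s. 2 / sqrt t * arctan (sqrt s / sqrt t))"
  define f where "f = (\<lambda>s. 1 / ((t + s) * sqrt s))"
  have 1: "DERIV F x :> f x" if "0 < ereal x" for x
  proof -
    have "x > 0" using that by simp
    have "(F has_real_derivative 2 / sqrt t * (inverse (1 + (sqrt x / sqrt t)\<^sup>2) * (inverse (sqrt x) / 2 / sqrt t))) (at x)"
      unfolding F_def
      by (intro DERIV_cmult DERIV_chain2[OF DERIV_arctan] DERIV_cdivide DERIV_real_sqrt \<open>x > 0\<close>)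
    also have "inverse (1 + (sqrt x / sqrt t)\<^sup>2) = t / (t + x)"
      using \<open>x > 0\<close> assms by (simp add: power_divide field_simps)
    also have "2 / sqrt t * (t / (t + x) * (inverse (sqrt x) / 2 / sqrt t)) = t / (sqrt t * sqrt t) * f x"
    proof -
      have "2 / a * (t / c * (inverse b / 2 / a)) = t / (a * a) * (1 / (c * b))"
        if "a \<noteq> 0" "b \<noteq> 0" "c \<noteq> 0" for a b c :: real
        using that by (simp add: field_simps)
      then show ?thesis unfolding f_def using \<open>x > 0\<close> assms by simp
    qed
    also have "\<dots> = f x"
      using assms by simp
    finally show ?thesis .
  qed
  have 2: "isCont f x" if "0 < ereal x" for x
    using that assms unfolding f_def by (auto intro!: continuous_intros)
  have A: "((F \<circ> real_of_ereal) \<longlongrightarrow> 0) (at_right 0)"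
  proof -
    have "isCont F 0" unfolding F_def using assms by (auto intro!: continuous_intros)
    then have "(F \<longlongrightarrow> F 0) (at_right 0)"
      unfolding isCont_def by (rule tendsto_within_subset) simp
    then show ?thesis unfolding zero_ereal_def
      by (simp only: ereal_tendsto_simps) (simp add: F_def)
  qed
  have B: "((F \<circ> real_of_ereal) \<longlongrightarrow> 2 / sqrt t * (pi / 2)) (at_left \<infinity>)"
  proof -
    have "filterlim (\<lambda>s. 1 / sqrt t * sqrt s) at_top at_top"
      using assms by (intro filterlim_tendsto_pos_mult_at_top[OF tendsto_const _ sqrt_at_top]) simp
    then have "filterlim (\<lambda>s. sqrt s / sqrt t) at_top at_top"
      by simp
    then have "(F \<longlongrightarrow> 2 / sqrt t * (pi / 2)) at_top"
      unfolding F_def by (intro tendsto_intros filterlim_compose[OF tendsto_arctan_at_top])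
    then show ?thesis by (simp add: ereal_tendsto_simps)
  qed
  have eI: "einterval 0 \<infinity> = {0<..}" by (auto simp: einterval_def)
  have nn: "f s \<ge> 0" if "s > 0" for s using that assms unfolding f_def by simp
  \<comment> \<open>The integrand is unbounded at 0 and the range is infinite, so the fundamental
    theorem is used with the limits of \<open>F\<close> at both ends. Nonnegativity of the integrand
    makes integrability part of its conclusion.\<close>
  note FTC = interval_integral_FTC_nonneg[OF _ 1 2 _ A B]
  have int: "integrable Rplus f"
    using FTC(1) nn by (simp add: eI set_integrable_restrict_space integrable_restrict_space set_integrable_def)
  have "integral\<^sup>L Rplus f = pi / sqrt t"
    using FTC(2) nn by (simp add: eI interval_lebesgue_integral_def integral_restrict_space set_lebesgue_integral_def)
  moreover have "(\<integral>\<^sup>+s. ennreal (f s) \<partial>Rplus) = ennreal (integral\<^sup>L Rplus f)"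
    by (intro nn_integral_eq_integral int AE_I2) (simp add: nn)
  ultimately show ?thesis by (simp add: f_def)
qed

lemma L2_measurable [measurable_dest]: "f \<in> L2_Rplus \<Longrightarrow> f \<in> borel_measurable Rplus"
  by (simp add: L2_Rplus_def)

lemma L2_Rplus_iff:
  "f \<in> L2_Rplus \<longleftrightarrow> f \<in> borel_measurable Rplus \<and> (\<integral>\<^sup>+t. ennreal ((cmod (f t))\<^sup>2) \<partial>Rplus) < \<infinity>"
  unfolding L2_Rplus_def by (auto simp: integrable_iff_bounded)

lemma nn_integral_L2_norm:
  "f \<in> L2_Rplus \<Longrightarrow> (\<integral>\<^sup>+t. ennreal ((cmod (f t))\<^sup>2) \<partial>Rplus) = ennreal ((L2_norm f)\<^sup>2)"
  unfolding L2_Rplus_def L2_norm_def by (simp add: nn_integral_eq_integral)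

lemma Rplus_interval:
  assumes "0 \<le> a"
  shows "{a<..<b} \<in> sets Rplus" and "a \<le> b \<Longrightarrow> emeasure Rplus {a<..<b} = ennreal (b - a)"
proof -
  have "{a<..<b} \<subseteq> {0<..}" using assms by auto
  then show "{a<..<b} \<in> sets Rplus" "a \<le> b \<Longrightarrow> emeasure Rplus {a<..<b} = ennreal (b - a)"
    by (simp_all add: sets_restrict_space_iff emeasure_restrict_space)
qed

text \<open>Evaluates the step functions on the quadrant that minorise and majorise the quadratic
  form in the proof of indefiniteness.\<close>

lemma has_bochner_integral_box:
  fixes a b c d :: real
  assumes "0 \<le> a" "a \<le> b" "0 \<le> c" "c \<le> d"
  shows "has_bochner_integral (Rplus \<Otimes>\<^sub>M Rplus)
    (\<lambda>x. indicator {a<..<b} (fst x) * indicator {c<..<d} (snd x)) ((b - a) * (d - c))"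
proof -
  have "emeasure (Rplus \<Otimes>\<^sub>M Rplus) ({a<..<b} \<times> {c<..<d}) = ennreal ((b - a) * (d - c))"
    using assms by (simp add: Rplus.emeasure_pair_measure_Times Rplus_interval ennreal_mult)
  moreover have "{a<..<b} \<times> {c<..<d} \<in> sets (Rplus \<Otimes>\<^sub>M Rplus)"
    using assms by (intro pair_measureI Rplus_interval)
  ultimately have "has_bochner_integral (Rplus \<Otimes>\<^sub>M Rplus)
      (indicator ({a<..<b} \<times> {c<..<d}) :: _ \<Rightarrow> real) ((b - a) * (d - c))"
    using has_bochner_integral_real_indicator[of "{a<..<b} \<times> {c<..<d}" "Rplus \<Otimes>\<^sub>M Rplus"] assms
    by (simp add: measure_def)
  then show ?thesis
    by (rule has_bochner_integral_cong[THEN iffD1, rotated -1]) (auto simp: indicator_def)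
qed

section \<open>The Schur test for kernels dominated by the Carleman kernel\<close>

text \<open>Convergence, boundedness and self-adjointness depend only on comparison with the
  Carleman kernel C/(t + s); the specific kernel enters only in the final theorem.\<close>

locale carleman_kernel =
  fixes h :: "real \<Rightarrow> real" and C :: real
  assumes kernel_measurable [measurable]: "h \<in> borel_measurable borel"
    and kernel_nonneg: "\<And>t. t > 0 \<Longrightarrow> 0 \<le> h t"
    and kernel_bound: "\<And>t. t > 0 \<Longrightarrow> h t \<le> C / t"
begin

lemma bound_nonneg: "0 \<le> C"
  using kernel_nonneg[of 1] kernel_bound[of 1] by simp

lemma nn_integral_kernel_weight:
  assumes "t > 0"
  shows "(\<integral>\<^sup>+s. ennreal (h (t + s) / sqrt s) \<partial>Rplus) \<le> ennreal (C * pi / sqrt t)"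
proof -
  have "(\<integral>\<^sup>+s. ennreal (h (t + s) / sqrt s) \<partial>Rplus)
      \<le> (\<integral>\<^sup>+s. ennreal C * ennreal (1 / ((t + s) * sqrt s)) \<partial>Rplus)"
  proof (rule nn_integral_mono)
    fix s assume "s \<in> space Rplus"
    then have "s > 0" by simp
    then have "h (t + s) / sqrt s \<le> C / (t + s) / sqrt s"
      using assms kernel_bound[of "t + s"] by (intro divide_right_mono) auto
    then show "ennreal (h (t + s) / sqrt s) \<le> ennreal C * ennreal (1 / ((t + s) * sqrt s))"
      using bound_nonneg \<open>s > 0\<close> assms by (subst ennreal_mult[symmetric]) (auto intro!: ennreal_leI)
  qed
  also have "\<dots> = ennreal (C * pi / sqrt t)"
    using assms bound_nonneg
    by (subst nn_integral_cmult) (simp_all add: nn_integral_carleman_weight flip: ennreal_mult)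
  finally show ?thesis .
qed

text \<open>Being \<open>ennreal\<close>-valued, it makes sense before the Hankel integral is known
  to converge.\<close>

definition abs_transform :: "(real \<Rightarrow> complex) \<Rightarrow> real \<Rightarrow> ennreal"
  where "abs_transform f t = (\<integral>\<^sup>+s. ennreal (h (t + s) * cmod (f s)) \<partial>Rplus)"

text \<open>The second factor left by the weighted Cauchy-Schwarz inequality of the Schur
  test.\<close>

definition weighted_transform :: "(real \<Rightarrow> complex) \<Rightarrow> real \<Rightarrow> ennreal"
  where "weighted_transform f t = (\<integral>\<^sup>+s. ennreal (h (t + s) * sqrt s * (cmod (f s))\<^sup>2) \<partial>Rplus)"

lemma measurable_transforms [measurable]:
  assumes [measurable]: "f \<in> borel_measurable Rplus"
  shows "abs_transform f \<in> borel_measurable Rplus"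
    and "weighted_transform f \<in> borel_measurable Rplus"
    and "hankel_operator h f \<in> borel_measurable Rplus"
  unfolding abs_transform_def weighted_transform_def hankel_operator_def by measurable

text \<open>Cauchy-Schwarz for the splitting of h |f| into sqrt(h / sqrt s) and sqrt(h sqrt s) |f|;
  the first factor is controlled by \<open>nn_integral_kernel_weight\<close>.\<close>

lemma abs_transform_le_weighted:
  assumes [measurable]: "f \<in> borel_measurable Rplus" and "t > 0"
  shows "(abs_transform f t)\<^sup>2 \<le> ennreal (C * pi / sqrt t) * weighted_transform f t"
proof -
  let ?u = "\<lambda>s. ennreal (sqrt (h (t + s) / sqrt s))"
  let ?v = "\<lambda>s. ennreal (sqrt (h (t + s) * sqrt s) * cmod (f s))"
  have h: "0 \<le> h (t + s)" if "s > 0" for s using kernel_nonneg[of "t + s"] that assms by simp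
  have "abs_transform f t = (\<integral>\<^sup>+s. ?u s * ?v s \<partial>Rplus)"
    unfolding abs_transform_def
  proof (rule nn_integral_cong)
    fix s assume "s \<in> space Rplus"
    then have "s > 0" by simp
    have "sqrt (h (t + s) / sqrt s) * sqrt (h (t + s) * sqrt s) = h (t + s)"
      using h \<open>s > 0\<close> by (simp add: real_sqrt_divide real_sqrt_mult)
    then have eq: "h (t + s) * cmod (f s)
        = sqrt (h (t + s) / sqrt s) * (sqrt (h (t + s) * sqrt s) * cmod (f s))"
      by (metis mult.assoc)
    show "ennreal (h (t + s) * cmod (f s)) = ?u s * ?v s"
      unfolding eq using h \<open>s > 0\<close> by (intro ennreal_mult) auto
  qed
  then have "(abs_transform f t)\<^sup>2 = (\<integral>\<^sup>+s. ?u s * ?v s \<partial>Rplus)\<^sup>2"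
    by (rule arg_cong)
  also have "\<dots> \<le> (\<integral>\<^sup>+s. (?u s)\<^sup>2 \<partial>Rplus) * (\<integral>\<^sup>+s. (?v s)\<^sup>2 \<partial>Rplus)"
    by (rule Cauchy_Schwarz_nn_integral) measurable
  also have "(\<integral>\<^sup>+s. (?u s)\<^sup>2 \<partial>Rplus) = (\<integral>\<^sup>+s. ennreal (h (t + s) / sqrt s) \<partial>Rplus)"
    using h by (intro nn_integral_cong) (simp add: ennreal_power)
  also have "(\<integral>\<^sup>+s. (?v s)\<^sup>2 \<partial>Rplus) = weighted_transform f t"
    unfolding weighted_transform_def
    using h by (intro nn_integral_cong) (simp add: ennreal_power power_mult_distrib)
  finally show ?thesis
    by (rule order_trans[OF _ mult_right_mono[OF nn_integral_kernel_weight[OF \<open>t > 0\<close>]]]) simp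
qed

text \<open>After Tonelli, symmetry of h(t + s) lets the weight estimate act on the inner integral
  over t. It yields C pi / sqrt(s), which cancels the weight sqrt(s).\<close>

lemma nn_integral_weighted_transform:
  assumes "f \<in> L2_Rplus"
  shows "(\<integral>\<^sup>+t. ennreal (1 / sqrt t) * weighted_transform f t \<partial>Rplus) \<le> ennreal (C * pi * (L2_norm f)\<^sup>2)"
proof -
  note [measurable] = L2_measurable[OF assms]
  have h: "0 \<le> h (t + s)" if "s > 0" "t > 0" for s t using kernel_nonneg[of "t + s"] that by simp
  have "(\<integral>\<^sup>+t. ennreal (1 / sqrt t) * weighted_transform f t \<partial>Rplus)
      = (\<integral>\<^sup>+t. \<integral>\<^sup>+s. ennreal (1 / sqrt t) * ennreal (h (t + s) * sqrt s * (cmod (f s))\<^sup>2) \<partial>Rplus \<partial>Rplus)"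
    unfolding weighted_transform_def by (subst nn_integral_cmult) auto
  also have "\<dots> = (\<integral>\<^sup>+s. \<integral>\<^sup>+t. ennreal (1 / sqrt t) * ennreal (h (t + s) * sqrt s * (cmod (f s))\<^sup>2) \<partial>Rplus \<partial>Rplus)"
    by (rule Rplus_pair.Fubini') measurable
  also have "\<dots> = (\<integral>\<^sup>+s. \<integral>\<^sup>+t. ennreal (sqrt s * (cmod (f s))\<^sup>2) * ennreal (h (s + t) / sqrt t) \<partial>Rplus \<partial>Rplus)"
    using h by (intro nn_integral_cong) (simp add: mult_ac add_ac flip: ennreal_mult)
  also have "\<dots> = (\<integral>\<^sup>+s. ennreal (sqrt s * (cmod (f s))\<^sup>2) * (\<integral>\<^sup>+t. ennreal (h (s + t) / sqrt t) \<partial>Rplus) \<partial>Rplus)"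
    by (subst nn_integral_cmult) auto
  also have "\<dots> \<le> (\<integral>\<^sup>+s. ennreal (sqrt s * (cmod (f s))\<^sup>2) * ennreal (C * pi / sqrt s) \<partial>Rplus)"
    by (intro nn_integral_mono mult_left_mono nn_integral_kernel_weight) auto
  also have "\<dots> = (\<integral>\<^sup>+s. ennreal (C * pi) * ennreal ((cmod (f s))\<^sup>2) \<partial>Rplus)"
    using bound_nonneg by (intro nn_integral_cong) (simp add: mult_ac flip: ennreal_mult)
  also have "\<dots> = ennreal (C * pi * (L2_norm f)\<^sup>2)"
    using bound_nonneg assms
    by (subst nn_integral_cmult) (simp_all add: nn_integral_L2_norm flip: ennreal_mult)
  finally show ?thesis .
qed

lemma nn_integral_abs_transform:
  assumes "f \<in> L2_Rplus"
  shows "(\<integral>\<^sup>+t. (abs_transform f t)\<^sup>2 \<partial>Rplus) \<le> ennreal ((C * pi * L2_norm f)\<^sup>2)"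
proof -
  note [measurable] = L2_measurable[OF assms]
  have "(\<integral>\<^sup>+t. (abs_transform f t)\<^sup>2 \<partial>Rplus)
      \<le> (\<integral>\<^sup>+t. ennreal (C * pi) * (ennreal (1 / sqrt t) * weighted_transform f t) \<partial>Rplus)"
  proof (rule nn_integral_mono)
    fix t assume "t \<in> space Rplus"
    then have "t > 0" by simp
    then have "ennreal (C * pi) * ennreal (1 / sqrt t) = ennreal (C * pi / sqrt t)"
      using bound_nonneg by (simp flip: ennreal_mult)
    then show "(abs_transform f t)\<^sup>2 \<le> ennreal (C * pi) * (ennreal (1 / sqrt t) * weighted_transform f t)"
      using abs_transform_le_weighted[of f t] \<open>t > 0\<close> by (simp flip: mult.assoc)
  qed
  also have "\<dots> = ennreal (C * pi) * (\<integral>\<^sup>+t. ennreal (1 / sqrt t) * weighted_transform f t \<partial>Rplus)"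
    by (rule nn_integral_cmult) measurable
  also have "\<dots> \<le> ennreal (C * pi) * ennreal (C * pi * (L2_norm f)\<^sup>2)"
    by (intro mult_left_mono nn_integral_weighted_transform assms) simp
  also have "\<dots> = ennreal ((C * pi * L2_norm f)\<^sup>2)"
    using bound_nonneg by (simp add: power2_eq_square mult_ac flip: ennreal_mult)
  finally show ?thesis .
qed

text \<open>Square integrability of \<open>abs_transform f\<close> would give finiteness only for
  almost every t. To cover every t > 0, \<open>weighted_transform f t\<close> is bounded pointwise
  through h(t + s) sqrt(s) \<le> C / sqrt(t).\<close>

lemma hankel_integrable:
  assumes "f \<in> L2_Rplus" "t > 0"
  shows "integrable Rplus (\<lambda>s. of_real (h (t + s)) * f s)"
proof (rule integrableI_bounded)
  note [measurable] = L2_measurable[OF assms(1)]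
  show "(\<lambda>s. of_real (h (t + s)) * f s) \<in> borel_measurable Rplus" by measurable
  have "weighted_transform f t \<le> (\<integral>\<^sup>+s. ennreal (C / sqrt t) * ennreal ((cmod (f s))\<^sup>2) \<partial>Rplus)"
    unfolding weighted_transform_def
  proof (rule nn_integral_mono)
    fix s assume "s \<in> space Rplus"
    then have "s > 0" by simp
    \<comment> \<open>The arithmetic-geometric mean inequality gives sqrt(s) / (t + s) \<le> 1 /
      sqrt(t).\<close>
    have "2 * (sqrt s * sqrt t) \<le> (sqrt s)\<^sup>2 + (sqrt t)\<^sup>2"
      using sum_squares_bound[of "sqrt s" "sqrt t"] by (simp add: mult_ac)
    then have "sqrt s * sqrt t \<le> t + s" using \<open>s > 0\<close> \<open>t > 0\<close> by simp
    then have "C * (sqrt s * sqrt t) \<le> C * (t + s)" by (intro mult_left_mono bound_nonneg)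
    then have "C / (t + s) * sqrt s \<le> C / sqrt t" using \<open>s > 0\<close> \<open>t > 0\<close> by (simp add: field_simps)
    moreover have "h (t + s) * sqrt s \<le> C / (t + s) * sqrt s"
      using kernel_bound[of "t + s"] \<open>s > 0\<close> \<open>t > 0\<close> by (intro mult_right_mono) auto
    ultimately have "h (t + s) * sqrt s * (cmod (f s))\<^sup>2 \<le> C / sqrt t * (cmod (f s))\<^sup>2"
      by (intro mult_right_mono) auto
    then show "ennreal (h (t + s) * sqrt s * (cmod (f s))\<^sup>2) \<le> ennreal (C / sqrt t) * ennreal ((cmod (f s))\<^sup>2)"
      using bound_nonneg \<open>t > 0\<close> by (subst ennreal_mult[symmetric]) (auto intro: ennreal_leI)
  qed
  also have "\<dots> = ennreal (C / sqrt t * (L2_norm f)\<^sup>2)"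
    using bound_nonneg assms
    by (subst nn_integral_cmult) (simp_all add: nn_integral_L2_norm flip: ennreal_mult)
  finally have "weighted_transform f t < \<infinity>"
    by (rule le_less_trans) simp
  then have "(abs_transform f t)\<^sup>2 < \<infinity>"
    by (intro le_less_trans[OF abs_transform_le_weighted]) (simp_all add: ennreal_mult_less_top assms)
  then have "abs_transform f t < \<infinity>"
    by (simp add: power2_eq_square ennreal_mult_less_top) auto
  also have "abs_transform f t = (\<integral>\<^sup>+s. ennreal (norm (of_real (h (t + s)) * f s)) \<partial>Rplus)"
    unfolding abs_transform_def
    using kernel_nonneg assms by (intro nn_integral_cong) (simp add: norm_mult)
  finally show "(\<integral>\<^sup>+s. ennreal (norm (of_real (h (t + s)) * f s)) \<partial>Rplus) < \<infinity>" .
qed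

lemma hankel_convergent: "hankel_convergent h"
  by (simp add: hankel_convergent_def hankel_integrable)

lemma norm_hankel_le:
  assumes "f \<in> L2_Rplus" "t > 0"
  shows "ennreal (cmod (hankel_operator h f t)) \<le> abs_transform f t"
proof -
  have "ennreal (cmod (hankel_operator h f t)) \<le> (\<integral>\<^sup>+s. ennreal (norm (of_real (h (t + s)) * f s)) \<partial>Rplus)"
    unfolding hankel_operator_def by (rule integral_norm_bound_ennreal[OF hankel_integrable[OF assms]])
  also have "\<dots> = abs_transform f t"
    unfolding abs_transform_def
    using kernel_nonneg assms by (intro nn_integral_cong) (simp add: norm_mult)
  finally show ?thesis .
qed

lemma hankel_L2:
  assumes "f \<in> L2_Rplus"
  shows "hankel_operator h f \<in> L2_Rplus"
    and "L2_norm (hankel_operator h f) \<le> C * pi * L2_norm f"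
proof -
  note [measurable] = L2_measurable[OF assms]
  have *: "(\<integral>\<^sup>+t. ennreal ((cmod (hankel_operator h f t))\<^sup>2) \<partial>Rplus) \<le> ennreal ((C * pi * L2_norm f)\<^sup>2)"
  proof (rule order_trans[OF nn_integral_mono nn_integral_abs_transform[OF assms]])
    fix t assume "t \<in> space Rplus"
    then show "ennreal ((cmod (hankel_operator h f t))\<^sup>2) \<le> (abs_transform f t)\<^sup>2"
      using power_mono[OF norm_hankel_le[OF assms], of t 2] by (simp add: ennreal_power)
  qed
  show L2: "hankel_operator h f \<in> L2_Rplus"
    unfolding L2_Rplus_iff infinity_ennreal_def
    by (intro conjI le_less_trans[OF * ennreal_less_top]) measurable
  have "(L2_norm (hankel_operator h f))\<^sup>2 \<le> (C * pi * L2_norm f)\<^sup>2"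
    using * by (simp add: nn_integral_L2_norm[OF L2])
  moreover have "0 \<le> C * pi * L2_norm f"
    using bound_nonneg by (simp add: L2_norm_def)
  ultimately show "L2_norm (hankel_operator h f) \<le> C * pi * L2_norm f"
    by (rule power2_le_imp_le)
qed

section \<open>The quadratic form: absolute convergence, symmetry and positivity\<close>

text \<open>Integrating the norm over s first leaves the pairing of |g| with
  \<open>abs_transform f\<close>, finite by Cauchy-Schwarz and the Schur bound. This is the
  hypothesis for every later exchange of integrals.\<close>

lemma hankel_form_integrable:
  assumes "f \<in> L2_Rplus" "g \<in> L2_Rplus"
  shows "integrable (Rplus \<Otimes>\<^sub>M Rplus) (\<lambda>(t, s). of_real (h (t + s)) * f s * cnj (g t))"
proof (rule integrableI_bounded)
  note [measurable] = assms[THEN L2_measurable]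
  show "(\<lambda>(t, s). of_real (h (t + s)) * f s * cnj (g t)) \<in> borel_measurable (Rplus \<Otimes>\<^sub>M Rplus)"
    by measurable
  have "(\<integral>\<^sup>+x. ennreal (norm (case x of (t, s) \<Rightarrow> of_real (h (t + s)) * f s * cnj (g t))) \<partial>(Rplus \<Otimes>\<^sub>M Rplus))
      = (\<integral>\<^sup>+t. \<integral>\<^sup>+s. ennreal (norm (of_real (h (t + s)) * f s * cnj (g t))) \<partial>Rplus \<partial>Rplus)"
    by (subst Rplus.nn_integral_fst[symmetric]) auto
  also have "\<dots> = (\<integral>\<^sup>+t. \<integral>\<^sup>+s. ennreal (cmod (g t)) * ennreal (h (t + s) * cmod (f s)) \<partial>Rplus \<partial>Rplus)"
    using kernel_nonneg by (intro nn_integral_cong) (simp add: norm_mult mult_ac flip: ennreal_mult)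
  also have "\<dots> = (\<integral>\<^sup>+t. ennreal (cmod (g t)) * abs_transform f t \<partial>Rplus)"
    unfolding abs_transform_def by (subst nn_integral_cmult) auto
  finally have "(\<integral>\<^sup>+x. ennreal (norm (case x of (t, s) \<Rightarrow> of_real (h (t + s)) * f s * cnj (g t))) \<partial>(Rplus \<Otimes>\<^sub>M Rplus))\<^sup>2
      = (\<integral>\<^sup>+t. ennreal (cmod (g t)) * abs_transform f t \<partial>Rplus)\<^sup>2" (is "?I\<^sup>2 = _") by simp
  also have "\<dots> \<le> (\<integral>\<^sup>+t. (ennreal (cmod (g t)))\<^sup>2 \<partial>Rplus) * (\<integral>\<^sup>+t. (abs_transform f t)\<^sup>2 \<partial>Rplus)"
    by (rule Cauchy_Schwarz_nn_integral) measurable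
  also have "\<dots> < \<infinity>"
    using le_less_trans[OF nn_integral_abs_transform[OF assms(1)] ennreal_less_top] assms(2)
    by (simp add: ennreal_mult_less_top ennreal_power nn_integral_L2_norm)
  finally show "?I < \<infinity>"
    by (simp add: power2_eq_square ennreal_mult_less_top) auto
qed

lemma L2_inner_hankel:
  assumes "f \<in> L2_Rplus" "g \<in> L2_Rplus"
  shows "L2_inner (hankel_operator h f) g
      = (LINT x|(Rplus \<Otimes>\<^sub>M Rplus). of_real (h (fst x + snd x)) * f (snd x) * cnj (g (fst x)))"
proof -
  have "(LINT x|(Rplus \<Otimes>\<^sub>M Rplus). of_real (h (fst x + snd x)) * f (snd x) * cnj (g (fst x)))
      = (LINT t|Rplus. LINT s|Rplus. of_real (h (t + s)) * f s * cnj (g t))"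
    using Rplus_pair.integral_fst'[OF hankel_form_integrable[OF assms]] by (simp add: case_prod_unfold)
  then show ?thesis
    unfolding L2_inner_def hankel_operator_def by simp
qed

text \<open>Self-adjointness is Fubini for the absolutely convergent form, since the kernel is real
  and symmetric in t and s.\<close>

lemma bounded_selfadjoint_hankel: "bounded_selfadjoint (hankel_operator h)"
  unfolding bounded_selfadjoint_def bounded_operator_def
proof (intro conjI ballI allI)
  fix f g assume fg: "f \<in> L2_Rplus" "g \<in> L2_Rplus"
  show "AE t in Rplus. hankel_operator h (\<lambda>s. f s + g s) t = hankel_operator h f t + hankel_operator h g t"
    using hankel_integrable[OF fg(1)] hankel_integrable[OF fg(2)]
    by (intro AE_I2) (simp add: hankel_operator_def distrib_left)
  have "L2_inner (hankel_operator h f) g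
      = (LINT t|Rplus. LINT s|Rplus. of_real (h (t + s)) * f s * cnj (g t))"
    unfolding L2_inner_def hankel_operator_def by simp
  also have "\<dots> = (LINT s|Rplus. LINT t|Rplus. of_real (h (t + s)) * f s * cnj (g t))"
    by (rule Rplus_pair.Fubini_integral[symmetric]) (rule hankel_form_integrable[OF fg])
  also have "\<dots> = (LINT s|Rplus. LINT t|Rplus. f s * cnj (of_real (h (s + t)) * g t))"
    by (simp add: mult_ac add_ac)
  also have "\<dots> = L2_inner f (hankel_operator h g)"
    unfolding L2_inner_def hankel_operator_def by (simp del: complex_cnj_mult)
  finally show "L2_inner (hankel_operator h f) g = L2_inner f (hankel_operator h g)" .
next
  show "\<exists>C. \<forall>f\<in>L2_Rplus. L2_norm (hankel_operator h f) \<le> C * L2_norm f"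
    using hankel_L2(2) by blast
qed (auto simp: hankel_L2 hankel_operator_def mult.left_commute)

text \<open>\<open>p\<close> is a feature map for the kernel, which makes the quadratic form an integral of squared moduli.\<close>

lemma positive_operatorI:
  fixes p :: "'a \<Rightarrow> real \<Rightarrow> real"
  assumes "sigma_finite_measure N"
    and [measurable]: "case_prod p \<in> borel_measurable (N \<Otimes>\<^sub>M Rplus)"
    and p_nonneg: "\<And>x t. t > 0 \<Longrightarrow> 0 \<le> p x t"
    and p: "\<And>t s. t > 0 \<Longrightarrow> s > 0 \<Longrightarrow> (\<integral>\<^sup>+x. ennreal (p x t * p x s) \<partial>N) = ennreal (h (t + s))"
  shows "positive_operator (hankel_operator h)"
  unfolding positive_operator_def
proof
  fix f assume f: "f \<in> L2_Rplus"
  note [measurable] = L2_measurable[OF f]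
  interpret N: sigma_finite_measure N by fact
  interpret P: pair_sigma_finite N "Rplus \<Otimes>\<^sub>M Rplus" ..
  interpret Q: pair_sigma_finite "Rplus \<Otimes>\<^sub>M Rplus" N ..
  define G where "G = (\<lambda>x ts. of_real (p x (fst ts) * p x (snd ts)) * (f (snd ts) * cnj (f (fst ts))))"
  define F where "F = (\<lambda>x. LINT s|Rplus. of_real (p x s) * f s)"
  have [measurable]: "(\<lambda>y. p (fst y) (fst (snd y))) \<in> borel_measurable (N \<Otimes>\<^sub>M (Rplus \<Otimes>\<^sub>M Rplus))"
    "(\<lambda>y. p (fst y) (snd (snd y))) \<in> borel_measurable (N \<Otimes>\<^sub>M (Rplus \<Otimes>\<^sub>M Rplus))"
    using measurable_compose[OF _ assms(2), of "\<lambda>y. (fst y, fst (snd y))"]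
      measurable_compose[OF _ assms(2), of "\<lambda>y. (fst y, snd (snd y))"] by simp_all
  have G_measurable [measurable]: "case_prod G \<in> borel_measurable (N \<Otimes>\<^sub>M (Rplus \<Otimes>\<^sub>M Rplus))"
    unfolding G_def by measurable
  have [measurable]: "(\<lambda>x. p x t) \<in> borel_measurable N" if "t > 0" for t
    using measurable_compose[OF _ assms(2), of "\<lambda>x. (x, t)"] that by simp
  have p_integral: "(LINT x|N. p x t * p x s) = h (t + s)" if "t > 0" "s > 0" for t s
    using that p_nonneg kernel_nonneg by (subst integral_eq_nn_integral) (auto simp: p)
  \<comment> \<open>Absolute integrability in all three variables: as p is nonnegative, integrating
    |G| over x first reproduces the kernel exactly and leaves the modulus of the integrand of the
    form.\<close>
  have "(\<integral>\<^sup>+y. ennreal (norm (case_prod G y)) \<partial>(N \<Otimes>\<^sub>M (Rplus \<Otimes>\<^sub>M Rplus)))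
    = (\<integral>\<^sup>+ts. \<integral>\<^sup>+x. ennreal (norm (G x ts)) \<partial>N \<partial>(Rplus \<Otimes>\<^sub>M Rplus))"
    by (subst P.nn_integral_snd[symmetric]) auto
  also have "\<dots> = (\<integral>\<^sup>+ts. ennreal (norm (case ts of (t, s) \<Rightarrow> of_real (h (t + s)) * f s * cnj (f t))) \<partial>(Rplus \<Otimes>\<^sub>M Rplus))"
  proof (rule nn_integral_cong, clarify)
    fix t s assume "(t, s) \<in> space (Rplus \<Otimes>\<^sub>M Rplus)"
    then have ts: "t > 0" "s > 0" by (auto simp: space_pair_measure)
    have "(\<integral>\<^sup>+x. ennreal (norm (G x (t, s))) \<partial>N)
        = (\<integral>\<^sup>+x. ennreal (p x t * p x s) * ennreal (cmod (f s * cnj (f t))) \<partial>N)"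
      using p_nonneg ts by (intro nn_integral_cong) (simp add: G_def norm_mult flip: ennreal_mult)
    also have "\<dots> = ennreal (h (t + s)) * ennreal (cmod (f s * cnj (f t)))"
      using ts by (subst nn_integral_multc) (simp_all add: p)
    finally show "(\<integral>\<^sup>+x. ennreal (norm (G x (t, s))) \<partial>N) = ennreal (norm (of_real (h (t + s)) * f s * cnj (f t)))"
      using kernel_nonneg[of "t + s"] ts by (simp add: norm_mult flip: ennreal_mult)
  qed
  also have "\<dots> < \<infinity>"
    using hankel_form_integrable[OF f f] by (simp add: integrable_iff_bounded)
  finally have int: "integrable (N \<Otimes>\<^sub>M (Rplus \<Otimes>\<^sub>M Rplus)) (case_prod G)"
    by (intro integrableI_bounded) auto
  have "L2_inner (hankel_operator h f) f = (LINT ts|(Rplus \<Otimes>\<^sub>M Rplus). LINT x|N. G x ts)"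
    unfolding L2_inner_hankel[OF f f]
  proof (rule Bochner_Integration.integral_cong[OF refl])
    fix ts assume "ts \<in> space (Rplus \<Otimes>\<^sub>M Rplus)"
    then have "fst ts > 0" "snd ts > 0" by (auto simp: space_pair_measure)
    then show "of_real (h (fst ts + snd ts)) * f (snd ts) * cnj (f (fst ts)) = (LINT x|N. G x ts)"
      unfolding G_def by (simp add: p_integral del: of_real_mult)
  qed
  also have "\<dots> = (LINT x|N. LINT ts|(Rplus \<Otimes>\<^sub>M Rplus). G x ts)"
    by (rule P.Fubini_integral[OF int])
  also have "\<dots> = (LINT x|N. of_real ((cmod (F x))\<^sup>2))"
  proof (rule integral_cong_AE)
    \<comment> \<open>For almost every x the slice is integrable over the quadrant, so its integral
      can be iterated and factors into conj(F x) F x.\<close>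
    have "AE x in N. integrable (Rplus \<Otimes>\<^sub>M Rplus) (G x)"
      using P.AE_integrable_fst[OF int] by simp
    then show "AE x in N. (LINT ts|(Rplus \<Otimes>\<^sub>M Rplus). G x ts) = of_real ((cmod (F x))\<^sup>2)"
    proof (rule AE_mp, intro AE_I2 impI)
      fix x assume "integrable (Rplus \<Otimes>\<^sub>M Rplus) (G x)"
      then have "(LINT ts|(Rplus \<Otimes>\<^sub>M Rplus). G x ts) = (LINT t|Rplus. LINT s|Rplus. G x (t, s))"
        by (rule Rplus_pair.integral_fst'[symmetric])
      also have "\<dots> = (LINT t|Rplus. LINT s|Rplus. cnj (of_real (p x t) * f t) * (of_real (p x s) * f s))"
        by (simp add: G_def mult_ac)
      \<comment> \<open>Should the integral defining \<open>F x\<close> diverge, both sides are 0 by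
        the default value of the integral.\<close>
      also have "\<dots> = cnj (F x) * F x"
        by (simp add: F_def del: complex_cnj_mult)
      also have "\<dots> = of_real ((cmod (F x))\<^sup>2)"
        by (metis complex_norm_square mult.commute)
      finally show "(LINT ts|(Rplus \<Otimes>\<^sub>M Rplus). G x ts) = of_real ((cmod (F x))\<^sup>2)" .
    qed
  qed (unfold F_def, measurable)
  also have "\<dots> = of_real (LINT x|N. (cmod (F x))\<^sup>2)" by (rule integral_complex_of_real)
  finally show "L2_inner (hankel_operator h f) f \<in> \<real>\<^sub>\<ge>\<^sub>0" by simp
qed

section \<open>Indefiniteness from explicit test functions\<close>

text \<open>For real test functions the form becomes a real integral, which can be estimated by
  pointwise comparison.\<close>

lemma hankel_form_real:
  assumes "(\<lambda>t. of_real (\<phi> t)) \<in> L2_Rplus"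
  shows "integrable (Rplus \<Otimes>\<^sub>M Rplus) (\<lambda>x. h (fst x + snd x) * \<phi> (snd x) * \<phi> (fst x))"
    and "L2_inner (hankel_operator h (\<lambda>t. of_real (\<phi> t))) (\<lambda>t. of_real (\<phi> t))
      = of_real (LINT x|(Rplus \<Otimes>\<^sub>M Rplus). h (fst x + snd x) * \<phi> (snd x) * \<phi> (fst x))"
proof -
  have "integrable (Rplus \<Otimes>\<^sub>M Rplus) (\<lambda>x. complex_of_real (h (fst x + snd x) * \<phi> (snd x) * \<phi> (fst x)))"
    using hankel_form_integrable[OF assms assms] by (simp add: case_prod_unfold)
  then show "integrable (Rplus \<Otimes>\<^sub>M Rplus) (\<lambda>x. h (fst x + snd x) * \<phi> (snd x) * \<phi> (fst x))"
    using complex_of_real_integrable_eq by blast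
  show "L2_inner (hankel_operator h (\<lambda>t. of_real (\<phi> t))) (\<lambda>t. of_real (\<phi> t))
      = of_real (LINT x|(Rplus \<Otimes>\<^sub>M Rplus). h (fst x + snd x) * \<phi> (snd x) * \<phi> (fst x))"
    unfolding L2_inner_hankel[OF assms assms] integral_complex_of_real[symmetric] by simp
qed

text \<open>The range [1,4] contains every sum t + s with both points in (1,2), or with one there
  and the other in (0,1).\<close>

lemma not_sign_definite_hankel:
  assumes "c > 0" and lower: "\<And>t. 1 \<le> t \<Longrightarrow> t \<le> 4 \<Longrightarrow> c \<le> h t"
    and lim: "(h \<longlongrightarrow> 0) (at_right 0)"
  shows "\<not> sign_definite (hankel_operator h)"
proof -
  \<comment> \<open>Chosen so that C/2 - 2 A c + 1 = -C/2 - 1 < 0; the left side will be the bound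
    for the form. The threshold 1/A^2 below makes the small square contribute at most 1.\<close>
  define A where "A = (C / 2 + 1) / c"
  have "A > 0" using bound_nonneg \<open>c > 0\<close> by (simp add: A_def add_nonneg_pos)
  then have "eventually (\<lambda>t. h t < 1 / A\<^sup>2) (at_right 0)"
    by (intro order_tendstoD(2)[OF lim]) simp
  then obtain \<delta> where \<delta>: "\<delta> > 0" "\<And>t. 0 < t \<Longrightarrow> t < \<delta> \<Longrightarrow> h t < 1 / A\<^sup>2"
    by (auto simp: eventually_at_right_field)
  \<comment> \<open>The bound 1 keeps (0,\<epsilon>) disjoint from (1,2), and \<delta>/2 ensures t +
    s < \<delta> on the square over (0,\<epsilon>).\<close>
  define \<epsilon> where "\<epsilon> = min 1 (\<delta> / 2)"
  have \<epsilon>: "0 < \<epsilon>" "\<epsilon> \<le> 1" "2 * \<epsilon> \<le> \<delta>" using \<delta> by (auto simp: \<epsilon>_def)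
  define u v :: "real \<Rightarrow> real" where "u = indicator {0<..<\<epsilon>}" and "v = indicator {1<..<2}"
  define \<phi> where "\<phi> B t = v t - B * u t" for B t
  have int: "integrable Rplus u" "integrable Rplus v"
    unfolding u_def v_def using \<epsilon>
    by (auto intro!: integrable_real_indicator simp: Rplus_interval)
  have \<phi>_L2: "(\<lambda>t. of_real (\<phi> B t)) \<in> L2_Rplus" for B
  proof -
    have "(cmod (of_real (\<phi> B t)))\<^sup>2 = v t + B\<^sup>2 * u t" for t
      using \<epsilon> by (auto simp: \<phi>_def u_def v_def indicator_def power2_eq_square)
    moreover have "(\<lambda>t. complex_of_real (\<phi> B t)) \<in> borel_measurable Rplus"
      unfolding \<phi>_def using int by measurable
    ultimately show ?thesis
      unfolding L2_Rplus_def using int by simp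
  qed
  define Q where "Q B = (LINT x|(Rplus \<Otimes>\<^sub>M Rplus). h (fst x + snd x) * \<phi> B (snd x) * \<phi> B (fst x))" for B
  \<comment> \<open>\<open>V\<close>, \<open>U\<close> and \<open>W\<close> are the indicators of
    the blocks into which the product of two copies of \<open>\<phi> B\<close> decomposes;
    \<open>W\<close> collects both mixed blocks.\<close>
  define V where "V x = v (fst x) * v (snd x)" for x
  define U where "U x = u (fst x) * u (snd x)" for x
  define W where "W x = u (fst x) * v (snd x) + v (fst x) * u (snd x)" for x
  have V: "has_bochner_integral (Rplus \<Otimes>\<^sub>M Rplus) V 1"
    using has_bochner_integral_box[of 1 2 1 2] by (simp add: V_def[abs_def] v_def)
  have U: "has_bochner_integral (Rplus \<Otimes>\<^sub>M Rplus) U (\<epsilon>\<^sup>2)"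
    using has_bochner_integral_box[of 0 \<epsilon> 0 \<epsilon>] \<epsilon> by (simp add: U_def[abs_def] u_def power2_eq_square)
  have W: "has_bochner_integral (Rplus \<Otimes>\<^sub>M Rplus) W (2 * \<epsilon>)"
    using has_bochner_integral_add[OF has_bochner_integral_box[of 0 \<epsilon> 1 2] has_bochner_integral_box[of 1 2 0 \<epsilon>]] \<epsilon>
    by (simp add: W_def[abs_def] u_def v_def)
  have "\<not> negative_operator (hankel_operator h)"
  proof
    assume "negative_operator (hankel_operator h)"
    then have "complex_of_real (Q 0) \<in> \<real>\<^sub>\<le>\<^sub>0"
      unfolding negative_operator_def Q_def using \<phi>_L2[of 0] hankel_form_real(2)[OF \<phi>_L2[of 0]] by metis
    then have "Q 0 \<le> 0" by simp
    \<comment> \<open>At B = 0 only the square over (1,2) remains, where the kernel is at least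
      c.\<close>
    moreover have "(LINT x|(Rplus \<Otimes>\<^sub>M Rplus). c * V x) \<le> Q 0"
      unfolding Q_def
    proof (rule integral_mono)
      show "integrable (Rplus \<Otimes>\<^sub>M Rplus) (\<lambda>x. c * V x)"
        using V by (auto simp: has_bochner_integral_iff)
      show "integrable (Rplus \<Otimes>\<^sub>M Rplus) (\<lambda>x. h (fst x + snd x) * \<phi> 0 (snd x) * \<phi> 0 (fst x))"
        by (rule hankel_form_real(1)[OF \<phi>_L2])
      fix x :: "real \<times> real"
      show "c * V x \<le> h (fst x + snd x) * \<phi> 0 (snd x) * \<phi> 0 (fst x)"
        using lower[of "fst x + snd x"] by (auto simp: \<phi>_def V_def v_def indicator_def)
    qed
    moreover have "(LINT x|(Rplus \<Otimes>\<^sub>M Rplus). c * V x) = c"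
      using V by (simp add: has_bochner_integral_iff)
    ultimately show False using \<open>c > 0\<close> by simp
  qed
  moreover have "\<not> positive_operator (hankel_operator h)"
  proof
    \<comment> \<open>Division by \<epsilon> gives the indicator \<open>u\<close> total mass 1, so
      the mixed blocks do not fade as \<epsilon> shrinks.\<close>
    define B where "B = A / \<epsilon>"
    have "B > 0" using \<open>A > 0\<close> \<epsilon> by (simp add: B_def)
    \<comment> \<open>A majorant of the integrand, block by block: h \<le> C/2 where t + s > 2, h
      \<ge> c on the mixed blocks because they carry the factor -B, and h \<le> 1/A^2 near the
      origin.\<close>
    define G where "G x = C / 2 * V x - B * c * W x + B\<^sup>2 * (1 / A\<^sup>2) * U x" for x
    assume "positive_operator (hankel_operator h)"
    then have "complex_of_real (Q B) \<in> \<real>\<^sub>\<ge>\<^sub>0"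
      unfolding positive_operator_def Q_def using \<phi>_L2[of B] hankel_form_real(2)[OF \<phi>_L2[of B]] by metis
    then have "0 \<le> Q B" by simp
    also have "Q B \<le> (LINT x|(Rplus \<Otimes>\<^sub>M Rplus). G x)"
      unfolding Q_def
    proof (rule integral_mono)
      show "integrable (Rplus \<Otimes>\<^sub>M Rplus) G"
        unfolding G_def[abs_def] using U V W by (auto simp: has_bochner_integral_iff)
      show "integrable (Rplus \<Otimes>\<^sub>M Rplus) (\<lambda>x. h (fst x + snd x) * \<phi> B (snd x) * \<phi> B (fst x))"
        by (rule hankel_form_real(1)[OF \<phi>_L2])
      fix x :: "real \<times> real"
      obtain t s where x: "x = (t, s)" by force
      have VV: "h (t + s) \<le> C / 2" if "t > 1" "s > 1"
      proof -
        have "C / (t + s) \<le> C / 2" using that bound_nonneg by (intro divide_left_mono) auto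
        moreover have "h (t + s) \<le> C / (t + s)" using kernel_bound[of "t + s"] that by simp
        ultimately show ?thesis by (rule order_trans[rotated])
      qed
      have UU: "B\<^sup>2 * h (t + s) \<le> B\<^sup>2 * (1 / A\<^sup>2)" if "0 < t" "t < \<epsilon>" "0 < s" "s < \<epsilon>"
        using \<delta>(2)[of "t + s"] that \<epsilon> by (intro mult_left_mono) auto
      have UV: "B * c \<le> B * h (t + s)" if "1 \<le> t + s" "t + s \<le> 4"
        using lower that \<open>B > 0\<close> by (intro mult_left_mono) auto
      show "h (fst x + snd x) * \<phi> B (snd x) * \<phi> B (fst x) \<le> G x"
        unfolding x G_def V_def U_def W_def \<phi>_def u_def v_def using VV UU UV \<epsilon>
        by (auto simp: indicator_def power2_eq_square mult_ac)
    qed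
    also have "\<dots> = C / 2 - B * c * (2 * \<epsilon>) + B\<^sup>2 * (1 / A\<^sup>2) * \<epsilon>\<^sup>2"
      unfolding G_def using U V W by (simp add: has_bochner_integral_iff)
    also have "\<dots> = - C / 2 - 1"
    proof -
      have "B * \<epsilon> = A" "A * c = C / 2 + 1" using \<epsilon> \<open>c > 0\<close> by (auto simp: B_def A_def)
      then have "B * c * (2 * \<epsilon>) = C + 2" "B\<^sup>2 * \<epsilon>\<^sup>2 = A\<^sup>2"
        by (simp_all flip: power_mult_distrib) (auto simp: algebra_simps)
      then show ?thesis using \<open>A > 0\<close> by (simp add: field_simps)
    qed
    finally show False using bound_nonneg by simp
  qed
  ultimately show ?thesis by (simp add: sign_definite_def)
qed

end

section \<open>The power-exponential kernel\<close>

text \<open>Apply ln x \<le> x at x = \<beta> t, with \<beta> small enough that m \<beta> \<le>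
  \<alpha>, so that the exponential absorbs the linear term. Dividing by m + 1 rather than m
  includes m = 0.\<close>

lemma powr_exp_bounded:
  fixes \<alpha> m :: real
  assumes "\<alpha> > 0" "m \<ge> 0"
  obtains C where "\<And>t. t > 0 \<Longrightarrow> t powr m * exp (- \<alpha> * t) \<le> C"
proof
  define \<beta> where "\<beta> = \<alpha> / (m + 1)"
  have "\<beta> > 0" "m * \<beta> \<le> \<alpha>" using assms by (auto simp: \<beta>_def field_simps)
  fix t :: real assume "t > 0"
  have "ln (\<beta> * t) \<le> \<beta> * t" using \<open>\<beta> > 0\<close> \<open>t > 0\<close> ln_le_minus_one[of "\<beta> * t"] by simp
  then have "ln t \<le> \<beta> * t - ln \<beta>" using \<open>\<beta> > 0\<close> \<open>t > 0\<close> by (simp add: ln_mult)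
  then have "m * ln t \<le> m * (\<beta> * t - ln \<beta>)" using assms by (intro mult_left_mono) auto
  moreover have "m * \<beta> * t \<le> \<alpha> * t" using \<open>m * \<beta> \<le> \<alpha>\<close> \<open>t > 0\<close> by (intro mult_right_mono) auto
  ultimately have "m * ln t - \<alpha> * t \<le> - m * ln \<beta>" by (simp add: algebra_simps)
  then show "t powr m * exp (- \<alpha> * t) \<le> exp (- m * ln \<beta>)"
    using \<open>t > 0\<close> by (simp add: powr_def flip: exp_add)
qed

text \<open>Euler's integral for Gamma after rescaling the variable by r. It represents a negative
  power as a Laplace transform with nonnegative density.\<close>

lemma nn_integral_Rplus_Gamma:
  assumes "a > 0" "r > 0"
  shows "(\<integral>\<^sup>+x. ennreal (x powr (a - 1) * exp (- (x * r))) \<partial>Rplus) = ennreal (Gamma a * r powr (- a))"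
proof -
  let ?I = "\<integral>\<^sup>+x. ennreal (x powr (a - 1) * exp (- (x * r))) \<partial>Rplus"
  have "ennreal (Gamma a) = (\<integral>\<^sup>+t. ennreal (indicator {0..} t * t powr (a - 1) / exp t) \<partial>lborel)"
    by (rule Gamma_conv_nn_integral_real[OF assms(1)])
  also have "\<dots> = ennreal \<bar>r\<bar> * (\<integral>\<^sup>+x. ennreal (indicator {0..} (0 + r * x) * (0 + r * x) powr (a - 1) / exp (0 + r * x)) \<partial>lborel)"
    using assms by (intro nn_integral_real_affine) auto
  also have "(\<integral>\<^sup>+x. ennreal (indicator {0..} (0 + r * x) * (0 + r * x) powr (a - 1) / exp (0 + r * x)) \<partial>lborel)
      = (\<integral>\<^sup>+x. ennreal (r powr (a - 1)) * (ennreal (x powr (a - 1) * exp (- (x * r))) * indicator {0<..} x) \<partial>lborel)"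
  \<comment> \<open>The closed and open half-lines give the same integrand even at x = 0, because
    \<open>0 powr (a - 1)\<close> is 0 by convention.\<close>
  proof (rule nn_integral_cong)
    fix x :: real
    consider "x < 0" | "x = 0" | "x > 0" by linarith
    then show "ennreal (indicator {0..} (0 + r * x) * (0 + r * x) powr (a - 1) / exp (0 + r * x))
        = ennreal (r powr (a - 1)) * (ennreal (x powr (a - 1) * exp (- (x * r))) * indicator {0<..} x)"
    proof cases
      case 1
      then have "r * x < 0" using assms by (simp add: mult_pos_neg)
      then show ?thesis using 1 by simp
    next
      case 3
      then show ?thesis using assms
        by (simp add: powr_mult exp_minus field_simps flip: ennreal_mult)
    qed simp
  qed
  also have "\<dots> = ennreal (r powr (a - 1)) * ?I"
    by (subst nn_integral_cmult) (simp_all add: nn_integral_restrict_space)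
  finally have "ennreal (Gamma a) = ennreal (r powr a) * ?I"
    using assms by (simp add: powr_diff flip: mult.assoc ennreal_mult)
  then have "ennreal (r powr (- a)) * ennreal (Gamma a) = ennreal (r powr (- a)) * ennreal (r powr a) * ?I"
    by (simp add: mult.assoc)
  also have "ennreal (r powr (- a)) * ennreal (r powr a) = 1"
    using assms by (simp flip: ennreal_mult powr_add)
  finally show ?thesis
    using assms by (simp add: mult.commute flip: ennreal_mult)
qed

theorem proposition5p4:
  fixes \<alpha> k :: real
    and h :: "real \<Rightarrow> real"
    and H :: "(real \<Rightarrow> complex) \<Rightarrow> real \<Rightarrow> complex"
  assumes "\<alpha> > 0" and "k \<ge> -1"
    and "h = (\<lambda>t. t powr k * exp (- \<alpha> * t))"
    and "H = hankel_operator h"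
  shows "hankel_convergent h \<and> bounded_selfadjoint H \<and>
    (k \<in> {-1..0} \<longrightarrow> positive_operator H) \<and>
    (k > 0 \<longrightarrow> \<not> sign_definite H)"
proof -
  \<comment> \<open>The condition k \<ge> -1 makes the exponent k + 1 nonnegative; dividing the
    bound by t gives h(t) \<le> C/t.\<close>
  obtain C where C: "\<And>t. t > 0 \<Longrightarrow> t powr (k + 1) * exp (- \<alpha> * t) \<le> C"
    using powr_exp_bounded[of \<alpha> "k + 1"] assms(1,2) by auto
  interpret carleman_kernel h C
  proof
    show "h \<in> borel_measurable borel" unfolding assms(3) by measurable
    show "0 \<le> h t" for t by (simp add: assms(3))
    show "h t \<le> C / t" if "t > 0" for t
      using C[OF that] that by (simp add: assms(3) powr_add field_simps)
  qed
  have "positive_operator H" if "k \<in> {-1..0}"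
  proof (cases "k = 0")
    case True
    \<comment> \<open>Here the kernel is exp(-\<alpha> t) exp(-\<alpha> s), so a one-point feature
      space suffices.\<close>
    show ?thesis unfolding assms(4)
    proof (rule positive_operatorI[where N = "count_space (UNIV :: unit set)" and p = "\<lambda>_ t. exp (- \<alpha> * t)"])
      show "(\<integral>\<^sup>+x. ennreal (exp (- \<alpha> * t) * exp (- \<alpha> * s)) \<partial>count_space (UNIV :: unit set)) = ennreal (h (t + s))"
        if "t > 0" "s > 0" for t s
        using that by (simp add: assms(3) True algebra_simps flip: exp_add)
    qed (auto intro: sigma_finite_measure_count_space_finite)
  next
    case False
    define a where "a = - k"
    have "a > 0" using that False by (simp add: a_def)
    then have Gamma: "Gamma a > 0" by (rule Gamma_real_pos)
    \<comment> \<open>The Laplace density is split evenly: each feature carries its square root, so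
      the product of the two features restores the full density.\<close>
    show ?thesis unfolding assms(4)
    proof (rule positive_operatorI[where N = Rplus
          and p = "\<lambda>x t. sqrt (x powr (a - 1) / Gamma a) * exp (- (x + \<alpha>) * t)"])
      fix t s :: real assume ts: "t > 0" "s > 0"
      have "(\<integral>\<^sup>+x. ennreal (sqrt (x powr (a - 1) / Gamma a) * exp (- (x + \<alpha>) * t)
            * (sqrt (x powr (a - 1) / Gamma a) * exp (- (x + \<alpha>) * s))) \<partial>Rplus)
          = (\<integral>\<^sup>+x. ennreal (exp (- \<alpha> * (t + s)) / Gamma a) * ennreal (x powr (a - 1) * exp (- (x * (t + s)))) \<partial>Rplus)"
      proof (rule nn_integral_cong)
        fix x :: real
        have "sqrt (x powr (a - 1) / Gamma a) * exp (- (x + \<alpha>) * t) * (sqrt (x powr (a - 1) / Gamma a) * exp (- (x + \<alpha>) * s))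
            = (sqrt (x powr (a - 1) / Gamma a))\<^sup>2 * (exp (- (x + \<alpha>) * t) * exp (- (x + \<alpha>) * s))"
          by (simp only: power2_eq_square mult_ac)
        also have "\<dots> = x powr (a - 1) / Gamma a * (exp (- \<alpha> * (t + s)) * exp (- (x * (t + s))))"
          using Gamma by (simp add: algebra_simps flip: exp_add)
        finally show "ennreal (sqrt (x powr (a - 1) / Gamma a) * exp (- (x + \<alpha>) * t)
            * (sqrt (x powr (a - 1) / Gamma a) * exp (- (x + \<alpha>) * s)))
          = ennreal (exp (- \<alpha> * (t + s)) / Gamma a) * ennreal (x powr (a - 1) * exp (- (x * (t + s))))"
          using Gamma by (simp add: mult_ac flip: ennreal_mult)
      qed
      also have "\<dots> = ennreal (exp (- \<alpha> * (t + s)) / Gamma a) * ennreal (Gamma a * (t + s) powr (- a))"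
        using ts \<open>a > 0\<close> by (subst nn_integral_cmult) (simp_all add: nn_integral_Rplus_Gamma)
      also have "\<dots> = ennreal (h (t + s))"
        using Gamma by (simp add: assms(3) a_def flip: ennreal_mult)
      finally show "(\<integral>\<^sup>+x. ennreal (sqrt (x powr (a - 1) / Gamma a) * exp (- (x + \<alpha>) * t)
            * (sqrt (x powr (a - 1) / Gamma a) * exp (- (x + \<alpha>) * s))) \<partial>Rplus) = ennreal (h (t + s))" .
    qed (use Gamma in \<open>auto intro: Rplus.sigma_finite_measure_axioms\<close>)
  qed
  moreover have "\<not> sign_definite H" if "k > 0"
    unfolding assms(4)
  proof (rule not_sign_definite_hankel)
    \<comment> \<open>On [1,4] the power is at least 1 and the exponential is smallest at 4.\<close>
    show "exp (- 4 * \<alpha>) > 0" by simp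
    show "exp (- 4 * \<alpha>) \<le> h t" if t: "1 \<le> t" "t \<le> 4" for t
    proof -
      have "exp (- 4 * \<alpha>) \<le> exp (- \<alpha> * t)" using t assms(1) by simp
      also have "\<dots> \<le> t powr k * exp (- \<alpha> * t)" using t \<open>k > 0\<close> by (simp add: ge_one_powr_ge_zero)
      finally show ?thesis by (simp add: assms(3))
    qed
    \<comment> \<open>Positivity of k is what makes the kernel vanish at the origin.\<close>
    have "((\<lambda>t. t powr k) \<longlongrightarrow> 0 powr k) (at_right 0)"
      using that by (intro tendsto_powr' tendsto_intros) (auto simp: eventually_at_filter)
    then have "((\<lambda>t. t powr k * exp (- \<alpha> * t)) \<longlongrightarrow> 0 powr k * exp (- \<alpha> * 0)) (at_right 0)"
      by (rule tendsto_mult) (intro tendsto_intros)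
    then show "(h \<longlongrightarrow> 0) (at_right 0)" by (simp add: assms(3))
  qed
  ultimately show ?thesis
    using hankel_convergent bounded_selfadjoint_hankel assms(4) by blast
qed

end
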